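(* There exist constants $c>0$ and $n_0\geq 2$ such that for all integers $n\ge n_0$ and all integers $q$ with $2\leq q\leq n$, writing $q=n^{\beta}$ (i.e. $\beta=\log_2 q/\log_2 n$), the uniformly random $n\times n$ jigsaw puzzle with $q$ colors (with rotation of pieces allowed) satisfies $$\mathbb{P}(\text{the puzzle has a unique edge assembly}) \leq \exp\left(-c\,\min(\beta, 1-\beta)^2\, n^2\right).$$
   Context: Random puzzle: the $n\times n$ board is cut into $n^2$ unit square cells. The resulting grid has $2n(n+1)$ unit edges (including those on the boundary of the board), and each of them is colored independently and uniformly at random with one of $q$ colors. The cell at each position, together with the colors of its four sides, is a jigsaw piece; thus two pieces that share a side have the same color on that side. Assemblies: the $n^2$ pieces are put unordered in a box, and their orientations are forgotten. Pieces may be rotated by multiples of $90^\circ$ but not flipped. A solution (valid assembly) is a placement of the $n^2$ pieces bijectively on the cells of the $n\times n$ board, together with a choice of one of the four orientations for each piece, such that whenever two pieces are placed in adjacent cells, the colors of their sides along the common edge coincide (there is no restriction along the boundary of the board). Each solution induces an edge coloring of the $2n(n+1)$ edges of the board. The puzzle has a unique edge assembly if the edge colorings induced by all solutions are the same up to rotation of the entire board by a multiple of $90^\circ$ (so solutions may differ by reshuffling identical pieces). *)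

theory Defs
  imports "HOL-Probability.Probability"
begin

text \<open>
  The board is the square with corners \<open>(0, 0)\<close> and \<open>(n, n)\<close>.
  \<open>Hor i j\<close> is the unit segment from \<open>(i, j)\<close> to \<open>(i + 1, j)\<close>, \<open>Ver i j\<close> the one from
  \<open>(i, j)\<close> to \<open>(i, j + 1)\<close>, and the pair \<open>(i, j)\<close> also names the cell whose lower left corner
  is that point.
\<close>

datatype edge = Hor nat nat | Ver nat nat

type_synonym cell = "nat \<times> nat"

type_synonym coloring = "edge \<Rightarrow> nat"

definition cells :: "nat \<Rightarrow> cell set" where
  "cells n = {..<n} \<times> {..<n}"

definition edges :: "nat \<Rightarrow> edge set" where
  "edges n = (\<lambda>(i, j). Hor i j) ` ({..<n} \<times> {..n}) \<union> (\<lambda>(i, j). Ver i j) ` ({..n} \<times> {..<n})"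

text \<open>Sides of a cell are numbered counterclockwise: 0 bottom, 1 right, 2 top, 3 left.\<close>

fun side :: "cell \<Rightarrow> nat \<Rightarrow> edge" where
  "side (i, j) k =
     (if k = 0 then Hor i j
      else if k = 1 then Ver (Suc i) j
      else if k = 2 then Hor i (Suc j)
      else Ver i j)"

definition random_coloring :: "nat \<Rightarrow> nat \<Rightarrow> coloring pmf" where
  "random_coloring n q = Pi_pmf (edges n) 0 (\<lambda>_. pmf_of_set {..<q})"

text \<open>
  A piece is named by the cell it was cut from.  An assembly is given by \<open>\<pi>\<close> and \<open>r\<close>: the cell
  \<open>c\<close> of the board receives the piece \<open>\<pi> c\<close>, turned clockwise by \<open>r c\<close> quarter turns.
  Such a turn brings side \<open>k + r c\<close> (modulo 4) of the piece to side \<open>k\<close> of the cell.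
\<close>

definition placed_color ::
    "coloring \<Rightarrow> (cell \<Rightarrow> cell) \<Rightarrow> (cell \<Rightarrow> nat) \<Rightarrow> cell \<Rightarrow> nat \<Rightarrow> nat" where
  "placed_color x \<pi> r c k = x (side (\<pi> c) ((k + r c) mod 4))"

definition is_solution ::
    "nat \<Rightarrow> coloring \<Rightarrow> (cell \<Rightarrow> cell) \<Rightarrow> (cell \<Rightarrow> nat) \<Rightarrow> bool" where
  "is_solution n x \<pi> r \<longleftrightarrow>
     bij_betw \<pi> (cells n) (cells n) \<and>
     (\<forall>c\<in>cells n. r c < 4) \<and>
     (\<forall>c\<in>cells n. \<forall>d\<in>cells n. \<forall>k<4. \<forall>l<4.
        c \<noteq> d \<and> side c k = side d l \<longrightarrow> placed_color x \<pi> r c k = placed_color x \<pi> r d l)"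

text \<open>For a solution, this determines \<open>y\<close> on \<open>edges n\<close> and leaves it arbitrary elsewhere.\<close>

definition induces ::
    "nat \<Rightarrow> coloring \<Rightarrow> (cell \<Rightarrow> cell) \<Rightarrow> (cell \<Rightarrow> nat) \<Rightarrow> coloring \<Rightarrow> bool" where
  "induces n x \<pi> r y \<longleftrightarrow> (\<forall>c\<in>cells n. \<forall>k<4. y (side c k) = placed_color x \<pi> r c k)"

text \<open>The counterclockwise quarter turn \<open>(x, y) \<mapsto> (n - y, x)\<close> of the board, acting on edges.\<close>

fun rotate_edge :: "nat \<Rightarrow> edge \<Rightarrow> edge" where
  "rotate_edge n (Hor i j) = Ver (n - j) i"
| "rotate_edge n (Ver i j) = Hor (n - Suc j) i"

definition same_up_to_rotation :: "nat \<Rightarrow> coloring \<Rightarrow> coloring \<Rightarrow> bool" where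
  "same_up_to_rotation n y z \<longleftrightarrow> (\<exists>m<4. \<forall>e\<in>edges n. z e = y ((rotate_edge n ^^ m) e))"

definition unique_edge_assembly :: "nat \<Rightarrow> coloring \<Rightarrow> bool" where
  "unique_edge_assembly n x \<longleftrightarrow>
     (\<forall>\<pi> r y \<pi>' r' y'.
        is_solution n x \<pi> r \<and> induces n x \<pi> r y \<and>
        is_solution n x \<pi>' r' \<and> induces n x \<pi>' r' y' \<longrightarrow> same_up_to_rotation n y y')"

lemma Hor_in_edges [simp]: "Hor i j \<in> edges n \<longleftrightarrow> i < n \<and> j \<le> n"
  and Ver_in_edges [simp]: "Ver i j \<in> edges n \<longleftrightarrow> i \<le> n \<and> j < n"
  by (auto simp: edges_def)

lemma finite_edges: "finite (edges n)"
  by (simp add: edges_def)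

lemma card_edges: "card (edges n) = 2 * n * (n + 1)"
proof -
  have "card (edges n) = card ((\<lambda>(i, j). Hor i j) ` ({..<n} \<times> {..n}))
      + card ((\<lambda>(i, j). Ver i j) ` ({..n} \<times> {..<n}))"
    unfolding edges_def by (rule card_Un_disjoint) auto
  also have "\<dots> = n * Suc n + Suc n * n"
    by (subst (1 2) card_image) (auto simp: inj_on_def card_cartesian_product)
  finally show ?thesis by simp
qed

lemma sides_eq_edges:
  assumes "n > 0"
  shows "(\<Union>c\<in>cells n. side c ` {..<4}) = edges n"
proof (intro equalityI subsetI)
  fix e assume "e \<in> (\<Union>c\<in>cells n. side c ` {..<4})"
  then show "e \<in> edges n"
    by (auto simp: cells_def)
next
  fix e assume e: "e \<in> edges n"
  have *: "\<exists>c\<in>cells n. \<exists>k<4. e = side c k"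
  proof (cases e)
    case (Hor i j)
    with e have ij: "i < n" "j \<le> n" by auto
    show ?thesis
    proof (cases "j < n")
      case True
      then show ?thesis using Hor ij
        by (intro bexI[of _ "(i, j)"] exI[of _ 0]) (auto simp: cells_def)
    next
      case False
      then show ?thesis using Hor ij assms
        by (intro bexI[of _ "(i, n - 1)"] exI[of _ 2]) (auto simp: cells_def)
    qed
  next
    case (Ver i j)
    with e have ij: "i \<le> n" "j < n" by auto
    show ?thesis
    proof (cases "i < n")
      case True
      then show ?thesis using Ver ij
        by (intro bexI[of _ "(i, j)"] exI[of _ 3]) (auto simp: cells_def)
    next
      case False
      then show ?thesis using Ver ij assms
        by (intro bexI[of _ "(n - 1, j)"] exI[of _ 1]) (auto simp: cells_def)
    qed
  qed
  then show "e \<in> (\<Union>c\<in>cells n. side c ` {..<4})" by blast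
qed

lemma side_inj: "k < 4 \<Longrightarrow> l < 4 \<Longrightarrow> side c k = side c l \<Longrightarrow> k = l"
  by (cases c) (auto split: if_splits)

lemma solution_induces:
  assumes "is_solution n x \<pi> r"
  shows "\<exists>y. induces n x \<pi> r y"
proof -
  define y where "y e = (SOME a. \<exists>c\<in>cells n. \<exists>k<4. side c k = e \<and> a = placed_color x \<pi> r c k)"
    for e
  have "y (side c k) = placed_color x \<pi> r c k" if c: "c \<in> cells n" and k: "k < 4" for c k
  proof -
    have "\<exists>d\<in>cells n. \<exists>l<4. side d l = side c k \<and> y (side c k) = placed_color x \<pi> r d l"
      unfolding y_def by (rule someI_ex) (use c k in blast)
    then obtain d l where d: "d \<in> cells n" "l < 4" "side d l = side c k"
        "y (side c k) = placed_color x \<pi> r d l"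
      by blast
    show ?thesis
    proof (cases "d = c")
      case True
      then have "l = k" using d(2,3) k side_inj by blast
      then show ?thesis using True d(4) by simp
    next
      case False
      then show ?thesis using assms c k d unfolding is_solution_def by metis
    qed
  qed
  then show ?thesis unfolding induces_def by blast
qed

lemma rotate_edge_in_edges: "e \<in> edges n \<Longrightarrow> rotate_edge n e \<in> edges n"
  by (cases e) auto

lemma rotate_edge_4: "e \<in> edges n \<Longrightarrow> (rotate_edge n ^^ 4) e = e"
  by (cases e) (auto simp: numeral_eq_Suc)

lemma induces_original: "induces n x (\<lambda>c. c) (\<lambda>_. 0) x"
  by (simp add: induces_def placed_color_def)

lemma is_solution_original: "is_solution n x (\<lambda>c. c) (\<lambda>_. 0)"
  by (auto simp: is_solution_def placed_color_def bij_betw_def)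

end

theory Submission
  imports Defs "HOL-Combinatorics.Permutations"
begin

text \<open>
  A coloring with a unique edge assembly is determined, up to a rotation of the board, by the
  multiset of its pieces.  So there are at most four times as many such colorings as there are
  multisets of \<open>n\<^sup>2\<close> pieces.  Turning each piece so that its bottom side carries the largest
  color leaves at most \<open>N = \<Sum>a<q. (a + 1)\<^sup>3 = (q (q + 1) / 2)\<^sup>2\<close> different pieces, and the number
  of multisets is at most \<open>(e (N + n\<^sup>2) / n\<^sup>2) ^ n\<^sup>2\<close>.  Divided by the number \<open>q ^ (2 n (n + 1))\<close>
  of all colorings this is exponentially small in \<open>n\<^sup>2\<close>, uniformly in \<open>2 \<le> q \<le> n\<close>, because
  \<open>e / 4 < 1\<close>.
\<close>

section \<open>Pieces normalized by rotation\<close>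

definition max_side :: "coloring \<Rightarrow> cell \<Rightarrow> nat" where
  "max_side x c = (SOME t. t < 4 \<and> (\<forall>k<4. x (side c k) \<le> x (side c t)))"

text \<open>Ties for the largest color are broken arbitrarily, so a piece may have several normal
  forms. The count rests on the other direction: equal normal forms come from pieces that agree up
  to rotation.\<close>

definition turned_piece :: "coloring \<Rightarrow> cell \<Rightarrow> nat \<times> nat \<times> nat \<times> nat" where
  "turned_piece x c =
     (let t = max_side x c in
      (x (side c (t mod 4)), x (side c ((1 + t) mod 4)),
       x (side c ((2 + t) mod 4)), x (side c ((3 + t) mod 4))))"

definition turned_pieces :: "nat \<Rightarrow> (nat \<times> nat \<times> nat \<times> nat) set" where
  "turned_pieces q = (SIGMA a:{..<q}. {..a} \<times> {..a} \<times> {..a})"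

definition piece_mset :: "nat \<Rightarrow> coloring \<Rightarrow> (nat \<times> nat \<times> nat \<times> nat) multiset" where
  "piece_mset n x = image_mset (turned_piece x) (mset_set (cells n))"

text \<open>The support of \<open>random_coloring\<close>; the value 0 off the board makes the set
  finite and matches the default of \<open>Pi_pmf\<close>.\<close>

definition board_colorings :: "nat \<Rightarrow> nat \<Rightarrow> coloring set" where
  "board_colorings n q = PiE_dflt (edges n) 0 (\<lambda>_. {..<q})"

lemma max_side: "max_side x c < 4" "k < 4 \<Longrightarrow> x (side c k) \<le> x (side c (max_side x c))"
proof -
  define m where "m = Max ((\<lambda>k. x (side c k)) ` {..<4})"
  have "m \<in> (\<lambda>k. x (side c k)) ` {..<4}"
    unfolding m_def by (rule Max_in) (auto simp: lessThan_empty_iff)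
  then obtain t where t: "t < 4" "m = x (side c t)" by blast
  have "x (side c k) \<le> x (side c t)" if "k < 4" for k
    unfolding t(2)[symmetric] m_def using that by (intro Max_ge) auto
  with t have "\<exists>t. t < 4 \<and> (\<forall>k<4. x (side c k) \<le> x (side c t))" by blast
  from someI_ex[OF this]
  have "max_side x c < 4 \<and> (\<forall>k<4. x (side c k) \<le> x (side c (max_side x c)))"
    unfolding max_side_def .
  then show "max_side x c < 4" "k < 4 \<Longrightarrow> x (side c k) \<le> x (side c (max_side x c))" by auto
qed

lemma finite_cells [simp]: "finite (cells n)"
  by (simp add: cells_def)

lemma card_cells: "card (cells n) = n\<^sup>2"
  by (simp add: cells_def power2_eq_square)

lemma side_in_edges: "c \<in> cells n \<Longrightarrow> side c k \<in> edges n"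
  by (cases c) (auto simp: cells_def)

lemma finite_turned_pieces: "finite (turned_pieces q)"
  by (auto simp: turned_pieces_def)

text \<open>Sum of cubes. Compared with the q^4 possible color quadruples this gains a factor of
  about 4, which is what outweighs the factor e lost in counting multisets.\<close>

lemma card_turned_pieces: "4 * card (turned_pieces q) = (q * (q + 1))\<^sup>2"
proof -
  have "card (turned_pieces q) = (\<Sum>a<q. (a + 1) ^ 3)"
    by (simp add: turned_pieces_def card_SigmaI card_cartesian_product power3_eq_cube algebra_simps)
  moreover have "4 * (\<Sum>a<q. (a + 1) ^ 3) = (q * (q + 1))\<^sup>2"
    by (induction q) (auto simp: power2_eq_square power3_eq_cube algebra_simps)
  ultimately show ?thesis by simp
qed

lemma piece_mset_in_multisets:
  assumes "x \<in> board_colorings n q"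
  shows "piece_mset n x \<in> multisets_of_size (turned_pieces q) (n\<^sup>2)"
proof -
  have "turned_piece x c \<in> turned_pieces q" if "c \<in> cells n" for c
  proof -
    have "x (side c k) < q" for k
      using assms side_in_edges[OF that] by (auto simp: board_colorings_def PiE_dflt_def)
    then show ?thesis
      using max_side(1)[of x c] max_side(2)[of _ x c] by (simp add: turned_pieces_def turned_piece_def Let_def)
  qed
  then show ?thesis
    by (auto simp: multisets_of_size_def piece_mset_def card_cells)
qed

section \<open>Colorings with the same pieces\<close>

lemma turned_piece_eq:
  assumes "turned_piece x c = turned_piece y d"
  shows "\<exists>r<4. \<forall>k<4. y (side d k) = x (side c ((k + r) mod 4))"
proof -
  define s t where "s = max_side x c" and "t = max_side y d"
  have st: "s < 4" "t < 4" unfolding s_def t_def by (rule max_side)+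
  have eq: "x (side c ((j + s) mod 4)) = y (side d ((j + t) mod 4))" if "j < 4" for j
  proof -
    have "j = 0 \<or> j = 1 \<or> j = 2 \<or> j = 3" using that by auto
    then show ?thesis
      using assms unfolding turned_piece_def Let_def s_def[symmetric] t_def[symmetric] by auto
  qed
  \<comment> \<open>This is s - t modulo 4, with \<open>4 - t\<close> in place of \<open>- t\<close>
    because subtraction on naturals truncates.\<close>
  define r where "r = (s + (4 - t)) mod 4"
  have "y (side d k) = x (side c ((k + r) mod 4))" if k: "k < 4" for k
  proof -
    \<comment> \<open>The position in the common normal form that side k of d is turned to, namely k
      - t modulo 4.\<close>
    define j where "j = (k + (4 - t)) mod 4"
    have "(j + t) mod 4 = (k + (4 - t) + t) mod 4"
      unfolding j_def by (rule mod_add_left_eq)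
    also have "\<dots> = k" using st k by simp
    finally have 1: "(j + t) mod 4 = k" .
    have "(j + s) mod 4 = (k + (4 - t) + s) mod 4"
      unfolding j_def by (rule mod_add_left_eq)
    also have "\<dots> = (k + r) mod 4"
      unfolding r_def mod_add_right_eq by (simp add: add_ac)
    finally have 2: "(j + s) mod 4 = (k + r) mod 4" .
    have "j < 4" by (simp add: j_def)
    from eq[OF this] show ?thesis unfolding 1 2 by simp
  qed
  moreover have "r < 4" by (simp add: r_def)
  ultimately show ?thesis by blast
qed

text \<open>Equal multisets yield a bijection of cells matching pieces up to rotation, so the pieces
  of x can be laid out to form y. Adjacent sides then agree automatically, since both show the color
  that y gives to their common edge.\<close>

lemma piece_mset_eq_solution:
  assumes "piece_mset n x = piece_mset n y"
  shows "\<exists>\<pi> r. is_solution n x \<pi> r \<and> induces n x \<pi> r y"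
proof -
  have "image_mset (turned_piece y) (mset_set (cells n))
      = image_mset (turned_piece x) (mset_set (cells n))"
    using assms by (simp add: piece_mset_def)
  from image_mset_eq_implies_permutes[OF finite_cells this]
  obtain \<pi> where \<pi>: "\<pi> permutes cells n"
      "\<forall>c\<in>cells n. turned_piece y c = turned_piece x (\<pi> c)"
    by blast
  have "\<exists>r<4. \<forall>k<4. y (side c k) = x (side (\<pi> c) ((k + r) mod 4))" if "c \<in> cells n" for c
    using \<pi>(2) that by (intro turned_piece_eq) simp
  then obtain r where r: "\<And>c. c \<in> cells n \<Longrightarrow> r c < 4"
      "\<And>c k. c \<in> cells n \<Longrightarrow> k < 4 \<Longrightarrow> y (side c k) = x (side (\<pi> c) ((k + r c) mod 4))"
    by metis
  have ind: "induces n x \<pi> r y"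
    using r by (simp add: induces_def placed_color_def)
  moreover have "is_solution n x \<pi> r"
    unfolding is_solution_def
  proof (intro conjI ballI allI impI)
    show "bij_betw \<pi> (cells n) (cells n)" using \<pi>(1) by (rule permutes_imp_bij)
  next
    fix c d k l
    assume "c \<in> cells n" "d \<in> cells n" "k < 4" "l < 4" "c \<noteq> d \<and> side c k = side d l"
    then show "placed_color x \<pi> r c k = placed_color x \<pi> r d l"
      using ind unfolding induces_def by metis
  qed (use r in auto)
  ultimately show ?thesis by blast
qed

lemma card_unique_fibre:
  assumes x: "x \<in> board_colorings n q" "unique_edge_assembly n x"
  shows "card {y \<in> board_colorings n q. piece_mset n y = piece_mset n x} \<le> 4"
proof -
  \<comment> \<open>Cutting off to 0 outside the board makes y equal to some \<open>rot m\<close> as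
    a function, not only on \<open>edges n\<close>.\<close>
  define rot where "rot m = (\<lambda>e. if e \<in> edges n then x ((rotate_edge n ^^ m) e) else 0)" for m
  have "{y \<in> board_colorings n q. piece_mset n y = piece_mset n x} \<subseteq> rot ` {..<4}"
  proof
    fix y assume "y \<in> {y \<in> board_colorings n q. piece_mset n y = piece_mset n x}"
    then have y: "y \<in> board_colorings n q" "piece_mset n x = piece_mset n y" by auto
    \<comment> \<open>Uniqueness is applied to the original assembly, which induces x, and to the
      one that rebuilds y.\<close>
    have "same_up_to_rotation n x y"
      using x(2) piece_mset_eq_solution[OF y(2)] is_solution_original induces_original
      unfolding unique_edge_assembly_def by blast
    then obtain m where "m < 4" "\<forall>e\<in>edges n. y e = x ((rotate_edge n ^^ m) e)"
      unfolding same_up_to_rotation_def by blast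
    moreover have "y e = 0" if "e \<notin> edges n" for e
      using y(1) that by (auto simp: board_colorings_def PiE_dflt_def)
    ultimately show "y \<in> rot ` {..<4}"
      by (auto simp: rot_def fun_eq_iff)
  qed
  then have "card {y \<in> board_colorings n q. piece_mset n y = piece_mset n x} \<le> card (rot ` {..<4})"
    by (intro card_mono) auto
  also have "\<dots> \<le> 4" using card_image_le[of "{..<4}" rot] by simp
  finally show ?thesis .
qed

section \<open>Counting colorings through multisets of pieces\<close>

lemma finite_board_colorings: "finite (board_colorings n q)"
  unfolding board_colorings_def by (rule finite_PiE_dflt) (auto simp: finite_edges)

lemma card_board_colorings: "card (board_colorings n q) = q ^ (2 * n * (n + 1))"
  unfolding board_colorings_def by (subst card_PiE_dflt) (auto simp: finite_edges card_edges)

text \<open>The map \<open>piece_mset n\<close> sends these colorings into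
  \<open>multisets_of_size (turned_pieces q) (n\<^sup>2)\<close>, and each of its fibres has at most
  four elements.\<close>

lemma card_unique:
  "card {x \<in> board_colorings n q. unique_edge_assembly n x}
     \<le> 4 * card (multisets_of_size (turned_pieces q) (n\<^sup>2))"
proof -
  let ?U = "{x \<in> board_colorings n q. unique_edge_assembly n x}"
  let ?M = "multisets_of_size (turned_pieces q) (n\<^sup>2)"
  have fin: "finite ?U" using finite_board_colorings by simp
  have "card ?U \<le> (\<Sum>M\<in>piece_mset n ` ?U. card {x \<in> ?U. piece_mset n x = M})"
    by (subst card_UN_disjoint[symmetric]) (use fin finite_board_colorings in \<open>auto intro!: card_mono\<close>)
  also have "\<dots> \<le> (\<Sum>M\<in>piece_mset n ` ?U. 4)"
  proof (rule sum_mono)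
    fix M assume "M \<in> piece_mset n ` ?U"
    then obtain x where x: "x \<in> ?U" "M = piece_mset n x" by blast
    have "card {y \<in> ?U. piece_mset n y = M}
        \<le> card {y \<in> board_colorings n q. piece_mset n y = piece_mset n x}"
      using x finite_board_colorings by (intro card_mono) auto
    also have "\<dots> \<le> 4" using x by (intro card_unique_fibre) auto
    finally show "card {y \<in> ?U. piece_mset n y = M} \<le> 4" .
  qed
  also have "\<dots> = 4 * card (piece_mset n ` ?U)" by simp
  also have "card (piece_mset n ` ?U) \<le> card ?M"
    by (intro card_mono finite_multisets_of_size finite_turned_pieces)
       (use piece_mset_in_multisets in auto)
  finally show ?thesis by simp
qed

section \<open>Estimates for the multisets and the probability\<close>

lemma power_le_fact_mult_exp: "real k ^ k \<le> fact k * exp (real k)"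
proof -
  \<comment> \<open>A single term of the exponential series at k, the one of index k, is at most the
    whole sum.\<close>
  have "(\<Sum>i\<in>{k}. real k ^ i / fact i) \<le> (\<Sum>i. real k ^ i / fact i)"
    by (rule sum_le_suminf) (use summable_exp_generic[of "real k"] in \<open>auto simp: divide_inverse_commute\<close>)
  also have "\<dots> = exp (real k)"
    by (simp add: exp_def divide_inverse_commute)
  finally show ?thesis by (simp add: field_simps)
qed

text \<open>The count is the binomial coefficient of |A| + k - 1 over k, hence at most (|A| + k)^k /
  k!, and k! is at least (k / e)^k.\<close>

lemma card_multisets_of_size_le:
  assumes "finite A" "k > 0"
  shows "real (card (multisets_of_size A k)) \<le> (exp 1 * (1 + card A / k)) ^ k"
proof -
  have "card (multisets_of_size A k) * fact k \<le> (card A + k - 1) ^ k"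
    using assms by (subst card_multisets_of_size) (auto intro: binomial_fact_pow)
  also have "\<dots> \<le> (card A + k) ^ k" by (intro power_mono) auto
  finally have "real (card (multisets_of_size A k) * fact k) \<le> real ((card A + k) ^ k)"
    by (simp only: of_nat_le_iff)
  then have "real (card (multisets_of_size A k)) * fact k \<le> real (card A + k) ^ k"
    by simp
  also have "\<dots> = (1 + card A / k) ^ k * real k ^ k"
    using assms by (simp add: power_mult_distrib[symmetric] field_simps)
  also have "\<dots> \<le> (1 + card A / k) ^ k * (fact k * exp (real k))"
    by (intro mult_left_mono power_le_fact_mult_exp) auto
  also have "\<dots> = ((exp 1 * (1 + card A / k)) ^ k) * fact k"
    by (simp add: power_mult_distrib exp_of_nat_mult[symmetric])
  finally show ?thesis by simp
qed

lemma piece_ratio_bound: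
  fixes n q :: real
  assumes "48 \<le> n" "2 \<le> q" "q \<le> n"
  shows "1 + (q * (q + 1))\<^sup>2 / 4 / n\<^sup>2 \<le> 7 / 24 * q\<^sup>2"
proof -
  have pos: "n\<^sup>2 > 0" "q\<^sup>2 > 0" using assms by auto
  have n: "48 * n \<le> n\<^sup>2" using assms by (simp add: power2_eq_square)
  have "(q + 1)\<^sup>2 \<le> q\<^sup>2 + 3 * n"
    using assms by (simp add: power2_eq_square algebra_simps)
  also have "\<dots> \<le> q\<^sup>2 + n\<^sup>2 / 16" using n by simp
  finally have "q\<^sup>2 * (q + 1)\<^sup>2 \<le> q\<^sup>2 * (q\<^sup>2 + n\<^sup>2 / 16)"
    by (rule mult_left_mono) auto
  \<comment> \<open>With equality at q = 2 and q = n, this expands to 4 n^2 + q^4 \<le> n^2 q^2 + 4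
    q^2. The errors are n^2 q^2 / 16 from (q + 1)^2 and 4 q^2 \<le> n^2 q^2 / 576, and 1 + 1/16 +
    1/576 < 7/6.\<close>
  moreover have "(q\<^sup>2 - 4) * (n\<^sup>2 - q\<^sup>2) \<ge> 0"
    using assms power_mono[of 2 q 2] power_mono[of q n 2] by (intro mult_nonneg_nonneg) auto
  moreover have "48 * q\<^sup>2 \<le> n\<^sup>2 * q\<^sup>2 / 48"
  proof -
    have "48 * 48 \<le> n * n" using assms by (intro mult_mono) auto
    then have "2304 * q\<^sup>2 \<le> n\<^sup>2 * q\<^sup>2"
      using pos by (intro mult_right_mono) (auto simp: power2_eq_square)
    then show ?thesis by simp
  qed
  moreover have "n\<^sup>2 * q\<^sup>2 > 0" using pos by simp
  ultimately have "4 * n\<^sup>2 + q\<^sup>2 * (q + 1)\<^sup>2 \<le> 7 / 6 * (n\<^sup>2 * q\<^sup>2)"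
    by (simp add: algebra_simps)
  then show ?thesis
    unfolding power_mult_distrib using pos by (simp add: field_simps)
qed

text \<open>Of the 2 n^2 + 2 n edges, 2 n^2 account for the power of q in the multiset bound, which
  cancels. The remaining factor q^(2 n) absorbs the 4 coming from rotations of the board.\<close>

lemma prob_unique_le:
  assumes "48 \<le> n" "2 \<le> q" "q \<le> n"
  shows "measure_pmf.prob (random_coloring n q) {x. unique_edge_assembly n x}
           \<le> exp (- (real n)\<^sup>2 / 8)"
proof -
  let ?k = "n\<^sup>2"
  let ?U = "{x \<in> board_colorings n q. unique_edge_assembly n x}"
  let ?M = "multisets_of_size (turned_pieces q) ?k"
  have q: "real q > 0" using assms by simp
  have "real (card (turned_pieces q)) = real (4 * card (turned_pieces q)) / 4" by simp
  also have "\<dots> = (real q * (real q + 1))\<^sup>2 / 4" unfolding card_turned_pieces by (simp add: algebra_simps)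
  finally have T: "real (card (turned_pieces q)) = (real q * (real q + 1))\<^sup>2 / 4" .
  have "real (card ?M) \<le> (exp 1 * (1 + card (turned_pieces q) / ?k)) ^ ?k"
    using assms by (intro card_multisets_of_size_le finite_turned_pieces) auto
  also have "\<dots> \<le> (7 / 8 * (real q)\<^sup>2) ^ ?k"
  proof (rule power_mono)
    have "1 + card (turned_pieces q) / ?k \<le> 7 / 24 * (real q)\<^sup>2"
      unfolding T of_nat_power using assms by (intro piece_ratio_bound) auto
    then have "exp 1 * (1 + card (turned_pieces q) / ?k) \<le> 3 * (7 / 24 * (real q)\<^sup>2)"
      by (intro mult_mono exp_le) auto
    then show "exp 1 * (1 + card (turned_pieces q) / ?k) \<le> 7 / 8 * (real q)\<^sup>2" by simp
  qed auto
  also have "\<dots> = (7 / 8) ^ ?k * real q ^ (2 * n\<^sup>2)"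
    unfolding power_mult_distrib power_mult ..
  finally have M: "real (card ?M) \<le> (7 / 8) ^ ?k * real q ^ (2 * n\<^sup>2)" .
  have "(4::real) \<le> 2 ^ 2" by simp
  also have "\<dots> \<le> 2 ^ (2 * n)" using assms by (intro power_increasing) auto
  also have "\<dots> \<le> real q ^ (2 * n)" using assms by (intro power_mono) auto
  finally have four: "4 \<le> real q ^ (2 * n)" .
  have "real (card ?U) \<le> 4 * real (card ?M)"
    using card_unique[of n q] by linarith
  also have "\<dots> \<le> real q ^ (2 * n) * ((7 / 8) ^ ?k * real q ^ (2 * n\<^sup>2))"
    using four M by (intro mult_mono) auto
  also have "\<dots> = (7 / 8) ^ ?k * real q ^ (2 * n * (n + 1))"
    by (simp add: power_add[symmetric] power2_eq_square algebra_simps)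
  finally have U: "real (card ?U) \<le> (7 / 8) ^ ?k * real q ^ (2 * n * (n + 1))" .
  \<comment> \<open>Independent uniform colors give the uniform distribution on
    \<open>board_colorings n q\<close>, so the probability is a quotient of cardinalities.\<close>
  have "random_coloring n q = pmf_of_set (board_colorings n q)"
    unfolding random_coloring_def board_colorings_def
    using assms by (intro Pi_pmf_of_set) (auto simp: finite_edges lessThan_empty_iff)
  moreover have "board_colorings n q \<noteq> {}"
    using card_board_colorings[of n q] assms by auto
  ultimately have "measure_pmf.prob (random_coloring n q) {x. unique_edge_assembly n x}
      = real (card ?U) / real q ^ (2 * n * (n + 1))"
    using finite_board_colorings[of n q]
    by (simp add: measure_pmf_of_set card_board_colorings Int_def)
  also have "\<dots> \<le> (7 / 8) ^ ?k"
    using U q by (subst pos_divide_le_eq) auto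
  \<comment> \<open>The inequality 1 + x \<le> exp x at x = -1/8.\<close>
  also have "\<dots> \<le> exp (- 1 / 8) ^ ?k"
    using exp_ge_add_one_self[of "- 1 / 8 :: real"] by (intro power_mono) auto
  also have "\<dots> = exp (- (real n)\<^sup>2 / 8)"
    by (simp add: exp_of_nat_mult[symmetric])
  finally show ?thesis .
qed

theorem mainTheorem3:
  "\<exists>c::real. \<exists>n0::nat. c > 0 \<and> n0 \<ge> 2 \<and>
     (\<forall>(n::nat) (q::nat). n \<ge> n0 \<and> 2 \<le> q \<and> q \<le> n \<longrightarrow>
        (let \<beta> = log 2 (real q) / log 2 (real n) in
         measure_pmf.prob (random_coloring n q) {x. unique_edge_assembly n x}
           \<le> exp (- c * (min \<beta> (1 - \<beta>))\<^sup>2 * (real n)\<^sup>2)))"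
proof (rule exI[of _ "1 / 8"], rule exI[of _ 48], intro conjI allI impI)
  fix n q :: nat
  assume "48 \<le> n \<and> 2 \<le> q \<and> q \<le> n"
  then have nq: "48 \<le> n" "2 \<le> q" "q \<le> n" by auto
  define \<beta> where "\<beta> = log 2 (real q) / log 2 (real n)"
  have "0 \<le> \<beta>" "\<beta> \<le> 1"
    using nq by (auto simp: \<beta>_def divide_le_eq_1)
  \<comment> \<open>As the factor depending on \<beta> is at most 1, the bound free of \<beta> in
    \<open>prob_unique_le\<close> is the stronger one.\<close>
  then have "(min \<beta> (1 - \<beta>))\<^sup>2 \<le> 1"
    by (intro power_le_one) auto
  then have "(min \<beta> (1 - \<beta>))\<^sup>2 * (real n)\<^sup>2 \<le> 1 * (real n)\<^sup>2"
    by (rule mult_right_mono) auto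
  then have "exp (- (real n)\<^sup>2 / 8) \<le> exp (- (1 / 8) * (min \<beta> (1 - \<beta>))\<^sup>2 * (real n)\<^sup>2)"
    by simp
  with prob_unique_le[OF nq]
  show "let \<beta> = log 2 (real q) / log 2 (real n) in
         measure_pmf.prob (random_coloring n q) {x. unique_edge_assembly n x}
           \<le> exp (- (1 / 8) * (min \<beta> (1 - \<beta>))\<^sup>2 * (real n)\<^sup>2)"
    unfolding Let_def \<beta>_def[symmetric] by linarith
qed auto

end
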